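(* Let $\lambda=(1^{e_1},\dots,n^{e_n})$ be a number-partition of $n$ (with $e_i$ parts equal to $i$) that is free of resonances. Let $\widehat{\mathcal{H}yp}^n_\lambda$ be the one-point compactification of $\mathcal{H}yp^n_\lambda$. Then $\widehat{\mathcal{H}yp}^n_\lambda$ is contractible if $e_i\ge 2$ for some $i$, and is homeomorphic to a sphere of dimension $e_1+\cdots+e_n$ if $0\le e_i\le 1$ for all $1\le i\le n$.
   Context: For $\lambda=(\lambda_1\le\cdots\le\lambda_t)$ a number-partition of $n$, $\mathcal{H}yp^n_\lambda\subseteq\mathbb{R}^n$ is the set of monic real polynomials $\prod_{i=1}^t(X-y_i)^{\lambda_i}$ with $y_1,\dots,y_t\in\mathbb{R}$ arbitrary, topologized via the coefficients. Writing the parts of $\lambda$ as $a_1,\dots,a_t$, $\lambda$ is free of resonances if there are no disjoint nonempty $I,J\subseteq[t]$ with $\sum_{i\in I}a_i=\sum_{j\in J}a_j$ and $a_i\neq a_j$ for all $i\in I,j\in J$. *)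

theory Defs
  imports "HOL-Analysis.Analysis" "HOL-Computational_Algebra.Polynomial"
begin

definition number_partition :: "nat \<Rightarrow> nat list \<Rightarrow> bool" where
  "number_partition n ps \<longleftrightarrow> sorted ps \<and> (\<forall>p\<in>set ps. 1 \<le> p) \<and> sum_list ps = n"

text \<open>Exponential notation for partitions: \<open>e i\<close> parts equal to \<open>i\<close>, for \<open>i = 1, \<dots>, n\<close>.
  Values of \<open>e\<close> outside \<open>{1..n}\<close> are ignored.\<close>
definition exponential_list :: "nat \<Rightarrow> (nat \<Rightarrow> nat) \<Rightarrow> nat list" where
  "exponential_list n e = concat (map (\<lambda>i. replicate (e i) i) [1..<n + 1])"

definition free_of_resonances :: "nat list \<Rightarrow> bool" where
  "free_of_resonances ps \<longleftrightarrow>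
     \<not> (\<exists>I J. I \<subseteq> {..<length ps} \<and> J \<subseteq> {..<length ps} \<and> I \<noteq> {} \<and> J \<noteq> {} \<and> I \<inter> J = {} \<and>
          (\<Sum>i\<in>I. ps ! i) = (\<Sum>j\<in>J. ps ! j) \<and> (\<forall>i\<in>I. \<forall>j\<in>J. ps ! i \<noteq> ps ! j))"

definition Hyp :: "nat list \<Rightarrow> real poly set" where
  "Hyp ps = range (\<lambda>y :: nat \<Rightarrow> real. \<Prod>i<length ps. [:- y i, 1:] ^ (ps ! i))"

text \<open>A monic polynomial of degree \<open>n\<close> is identified with the point of \<open>\<real>\<^sup>n\<close> given by
  its non-leading coefficients.\<close>
definition coeff_vector :: "nat \<Rightarrow> real poly \<Rightarrow> nat \<Rightarrow> real" where
  "coeff_vector n p = (\<lambda>i. if i < n then coeff p i else 0)"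

text \<open>When \<open>ps\<close> has sum \<open>n\<close>, \<open>coeff_vector n\<close> is injective on \<open>Hyp ps\<close>, so the pullback
  is the subspace topology from \<open>\<real>\<^sup>n\<close>.\<close>
definition Hyp_topology :: "nat \<Rightarrow> nat list \<Rightarrow> real poly topology" where
  "Hyp_topology n ps = pullback_topology (Hyp ps) (coeff_vector n) (Euclidean_space n)"

lemma topspace_Hyp_topology [simp]: "topspace (Hyp_topology n ps) = Hyp ps"
  by (auto simp: Hyp_topology_def topspace_pullback_topology topspace_Euclidean_space
      coeff_vector_def)

lemma Hyp_monic_degree:
  assumes "p \<in> Hyp ps"
  shows "lead_coeff p = 1" "degree p = sum_list ps"
proof -
  obtain y :: "nat \<Rightarrow> real" where p: "p = (\<Prod>i<length ps. [:- y i, 1:] ^ (ps ! i))"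
    using assms by (auto simp: Hyp_def)
  show "lead_coeff p = 1"
    by (simp add: p lead_coeff_prod lead_coeff_power)
  have "degree p = (\<Sum>i<length ps. ps ! i)"
    by (simp add: p degree_prod_eq_sum_degree degree_power_eq)
  then show "degree p = sum_list ps"
    by (simp add: sum_list_sum_nth atLeast0LessThan)
qed

lemma inj_on_coeff_vector:
  assumes "sum_list ps = n"
  shows "inj_on (coeff_vector n) (Hyp ps)"
proof (rule inj_onI, rule poly_eqI)
  fix p q k assume pq: "p \<in> Hyp ps" "q \<in> Hyp ps" "coeff_vector n p = coeff_vector n q"
  note d = Hyp_monic_degree[OF pq(1)] Hyp_monic_degree[OF pq(2)]
  consider "k < n" | "k = n" | "k > n" by linarith
  then show "coeff p k = coeff q k"
  proof cases
    case 1
    then show ?thesis using fun_cong[OF pq(3), of k] by (simp add: coeff_vector_def)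
  next
    case 2
    then show ?thesis using d assms by simp
  next
    case 3
    then show ?thesis using d assms by (simp add: coeff_eq_0)
  qed
qed

end

theory Submission
  imports Defs
begin

text \<open>Freeness of resonances ensures that a polynomial in \<^term>\<open>Hyp ps\<close> determines, for each part
  size, the multiset of the roots attached to the parts of that size. Hence \<^term>\<open>Hyp ps\<close> is in
  continuous bijection with the closed cone of root vectors that are sorted within each block of
  equal parts. Since the roots of a monic polynomial are bounded in terms of its coefficients, the
  bijection is proper, so a homeomorphism. If all parts are distinct, the cone is a Euclidean space
  and its compactification a sphere by stereographic projection. If some part is repeated, pushing
  the largest root of that part to infinity contracts the compactification to the added point.\<close>

subsection \<open>Root vectors\<close>

text \<open>Equal parts, one from each side, are cancelled until none is left. Then \<open>P\<close>
  and \<open>Q\<close> are disjoint with no value in common and would form a resonance were both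
  nonempty; as parts are positive, equal sums force both to be empty.\<close>

lemma card_parts_eq_of_sum_eq:
  assumes "free_of_resonances ps" "\<forall>p\<in>set ps. 1 \<le> p"
    and "P \<subseteq> {..<length ps}" "Q \<subseteq> {..<length ps}" "(\<Sum>i\<in>P. ps ! i) = (\<Sum>i\<in>Q. ps ! i)"
  shows "card {i\<in>P. ps ! i = a} = card {i\<in>Q. ps ! i = a}"
  using assms(3-5)
proof (induction "card P" arbitrary: P Q rule: less_induct)
  case less
  have fin: "finite P" "finite Q"
    using less.prems finite_subset by blast+
  have pos: "0 < ps ! i" if "i < length ps" for i
    using assms(2) that nth_mem by fastforce
  show ?case
  proof (cases "\<exists>i\<in>P. \<exists>j\<in>Q. ps ! i = ps ! j")
    case True
    then obtain i j where ij: "i \<in> P" "j \<in> Q" "ps ! i = ps ! j" by auto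
    have "card (P - {i}) < card P"
      using ij fin by (meson card_Diff1_less)
    moreover have "(\<Sum>i\<in>P - {i}. ps ! i) = (\<Sum>i\<in>Q - {j}. ps ! i)"
      using less.prems(3) ij fin by (simp add: sum_diff1_nat)
    ultimately have *: "card {k\<in>P - {i}. ps ! k = a} = card {k\<in>Q - {j}. ps ! k = a}"
      using less.hyps[of "P - {i}" "Q - {j}"] less.prems by blast
    have eq: "{k\<in>P. ps ! k = a} = (if ps ! i = a then insert i {k\<in>P - {i}. ps ! k = a} else {k\<in>P - {i}. ps ! k = a})"
       "{k\<in>Q. ps ! k = a} = (if ps ! j = a then insert j {k\<in>Q - {j}. ps ! k = a} else {k\<in>Q - {j}. ps ! k = a})"
      using ij by auto
    show ?thesis
      unfolding eq using * ij(3) fin by simp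
  next
    case False
    then have "P \<inter> Q = {}" by auto
    then have "P = {} \<or> Q = {}"
      using assms(1) less.prems False unfolding free_of_resonances_def by metis
    moreover have "P = {} \<longleftrightarrow> Q = {}"
    proof -
      have "(\<Sum>i\<in>P. ps ! i) = 0 \<longleftrightarrow> P = {}" "(\<Sum>i\<in>Q. ps ! i) = 0 \<longleftrightarrow> Q = {}"
        using fin less.prems pos by (fastforce simp: subset_iff)+
      then show ?thesis using less.prems by simp
    qed
    ultimately show ?thesis by auto
  qed
qed

definition root_poly :: "nat list \<Rightarrow> (nat \<Rightarrow> real) \<Rightarrow> real poly" where
  "root_poly ps y = (\<Prod>i<length ps. [:- y i, 1:] ^ (ps ! i))"

text \<open>Used to turn an equality of two root polynomials into equalities of sums of parts, one
  for each real number \<open>r\<close>, which is the form that freeness of resonances speaks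
  about.\<close>

lemma order_prod_linear_powers:
  fixes y :: "'i \<Rightarrow> real"
  assumes "finite A"
  shows "order r (\<Prod>i\<in>A. [:- y i, 1:] ^ m i) = (\<Sum>i\<in>{i\<in>A. y i = r}. m i)"
  using assms
proof (induction A rule: finite_induct)
  case (insert j A)
  have nz: "[:- y j, 1:] ^ m j * (\<Prod>i\<in>A. [:- y i, 1:] ^ m i) \<noteq> 0"
    using insert.hyps(1) by simp
  have "order r ([:- y j, 1:] ^ m j) = (if y j = r then m j else 0)"
    by (auto simp: order_power_n_n intro!: order_0I)
  moreover have "{i \<in> insert j A. y i = r} = (if y j = r then insert j {i\<in>A. y i = r} else {i\<in>A. y i = r})"
    by auto
  ultimately show ?case
    using insert nz by (simp add: order_mult)
qed simp

text \<open>A fundamental domain for the permutations of the roots preserving multiplicities.\<close>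
definition sorted_roots :: "nat list \<Rightarrow> (nat \<Rightarrow> real) set" where
  "sorted_roots ps = {x. (\<forall>i\<ge>length ps. x i = 0) \<and>
     (\<forall>i j. i < j \<longrightarrow> j < length ps \<longrightarrow> ps ! i = ps ! j \<longrightarrow> x i \<le> x j)}"

text \<open>The multiplicity of \<open>r\<close> gives equal sums of the parts placed at
  \<open>r\<close>, hence equally many parts of each size there. So within a block of equal parts
  both vectors list the same multiset of roots, and sortedness fixes the order.\<close>

lemma inj_on_root_poly:
  assumes res: "free_of_resonances ps" and pos: "\<forall>p\<in>set ps. 1 \<le> p"
  shows "inj_on (root_poly ps) (sorted_roots ps)"
proof (rule inj_onI)
  fix x y assume x: "x \<in> sorted_roots ps" and y: "y \<in> sorted_roots ps"
    and eq: "root_poly ps x = root_poly ps y"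
  show "x = y"
  proof
    fix k
    show "x k = y k"
    proof (cases "k < length ps")
      case False
      then show ?thesis using x y by (simp add: sorted_roots_def)
    next
      case True
      define B where "B = {i. i < length ps \<and> ps ! i = ps ! k}"
      have fB: "finite B" and kB: "k \<in> B" by (auto simp: B_def True)
      have cnt: "card {i\<in>B. x i = r} = card {i\<in>B. y i = r}" for r
      proof -
        have "(\<Sum>i | i \<in> {..<length ps} \<and> x i = r. ps ! i) = (\<Sum>i | i \<in> {..<length ps} \<and> y i = r. ps ! i)"
          using arg_cong[OF eq, of "order r"] by (simp add: root_poly_def order_prod_linear_powers)
        then have "card {i \<in> {i. i \<in> {..<length ps} \<and> x i = r}. ps ! i = ps ! k}
            = card {i \<in> {i. i \<in> {..<length ps} \<and> y i = r}. ps ! i = ps ! k}"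
          by (intro card_parts_eq_of_sum_eq res pos) auto
        moreover have "{i \<in> {i. i \<in> {..<length ps} \<and> z i = r}. ps ! i = ps ! k} = {i\<in>B. z i = r}" for z :: "nat \<Rightarrow> real"
          by (auto simp: B_def)
        ultimately show ?thesis by simp
      qed
      define L where "L = sorted_list_of_set B"
      have L: "set L = B" "sorted L" "distinct L" using fB by (auto simp: L_def)
      have sorted: "sorted (map z L)" if "z \<in> sorted_roots ps" for z
      proof -
        have "z i \<le> z j" if "i \<in> B" "j \<in> B" "i \<le> j" for i j
          using that \<open>z \<in> sorted_roots ps\<close> by (cases "i = j") (auto simp: B_def sorted_roots_def)
        then show ?thesis
          using L by (auto simp: sorted_map intro: sorted_wrt_mono_rel)
      qed
      have "mset (map x L) = mset (map y L)"
      proof (rule multiset_eqI)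
        fix r
        have "count (mset (map z L)) r = card {i\<in>B. z i = r}" for z :: "nat \<Rightarrow> real"
        proof -
          have "mset L = mset_set B" using L by (metis mset_set_set)
          moreover have "z -` {r} \<inter> B = {i\<in>B. z i = r}" by auto
          ultimately show ?thesis using fB by (simp add: count_image_mset)
        qed
        then show "count (mset (map x L)) r = count (mset (map y L)) r" using cnt by simp
      qed
      \<comment> \<open>Both lists are sorted, so each is the sort of their common multiset.\<close>
      then have "map x L = map y L"
        using sorted[OF x] sorted[OF y] by (metis properties_for_sort)
      then show ?thesis using kB L by (simp add: map_eq_conv)
    qed
  qed
qed

text \<open>A permutation maximizing \<open>\<Sum>i. i * y (\<pi> i)\<close> sorts \<open>y\<close>, since transposing an
  inversion increases the sum.\<close>
lemma root_poly_sorted_roots: "root_poly ps ` sorted_roots ps = Hyp ps"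
proof
  show "root_poly ps ` sorted_roots ps \<subseteq> Hyp ps"
    by (auto simp: Hyp_def root_poly_def)
  show "Hyp ps \<subseteq> root_poly ps ` sorted_roots ps"
  proof
    fix p assume "p \<in> Hyp ps"
    then obtain y where p: "p = root_poly ps y" by (auto simp: Hyp_def root_poly_def)
    let ?t = "length ps"
    let ?\<Pi> = "{\<pi>. \<pi> permutes {..<?t} \<and> (\<forall>i<?t. ps ! \<pi> i = ps ! i)}"
    define S where "S = (\<lambda>\<pi>. \<Sum>i<?t. real i * y (\<pi> i))"
    have "finite ?\<Pi>" by (rule finite_subset[OF _ finite_permutations[of "{..<?t}"]]) auto
    moreover have "id \<in> ?\<Pi>" by (simp add: permutes_id)
    ultimately obtain \<pi> where \<pi>: "\<pi> \<in> ?\<Pi>" and "\<And>\<rho>. \<rho> \<in> ?\<Pi> \<Longrightarrow> - S \<pi> \<le> - S \<rho>"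
      using ex_is_arg_min_if_finite[of ?\<Pi> "\<lambda>\<rho>. - S \<rho>"] unfolding is_arg_min_linorder by blast
    then have max: "\<And>\<rho>. \<rho> \<in> ?\<Pi> \<Longrightarrow> S \<rho> \<le> S \<pi>" by simp
    define x where "x = (\<lambda>i. if i < ?t then y (\<pi> i) else 0)"
    have "x i \<le> x j" if ij: "i < j" "j < ?t" "ps ! i = ps ! j" for i j
    proof (rule ccontr)
      assume "\<not> x i \<le> x j"
      then have gt: "y (\<pi> i) > y (\<pi> j)" using ij by (simp add: x_def)
      let ?\<rho> = "\<pi> \<circ> Transposition.transpose i j"
      have "?\<rho> \<in> ?\<Pi>"
        using \<pi> ij by (auto intro!: permutes_compose permutes_swap_id simp: Transposition.transpose_def)
      then have "S ?\<rho> \<le> S \<pi>" by (rule max)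
      moreover have split: "S \<sigma> = (\<Sum>k\<in>{..<?t} - {i,j}. real k * y (\<sigma> k)) + real i * y (\<sigma> i) + real j * y (\<sigma> j)" for \<sigma>
      proof -
        have "{..<?t} = insert i (insert j ({..<?t} - {i,j}))" using ij by auto
        then have "S \<sigma> = (\<Sum>k\<in>insert i (insert j ({..<?t} - {i,j})). real k * y (\<sigma> k))"
          by (simp add: S_def)
        also have "\<dots> = (\<Sum>k\<in>{..<?t} - {i,j}. real k * y (\<sigma> k)) + real i * y (\<sigma> i) + real j * y (\<sigma> j)"
          using ij by (subst sum.insert; simp)+
        finally show ?thesis .
      qed
      moreover have "(\<Sum>k\<in>{..<?t} - {i,j}. real k * y (?\<rho> k)) = (\<Sum>k\<in>{..<?t} - {i,j}. real k * y (\<pi> k))"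
        by (intro sum.cong) (auto simp: Transposition.transpose_def)
      ultimately have "real i * y (\<pi> j) + real j * y (\<pi> i) \<le> real i * y (\<pi> i) + real j * y (\<pi> j)"
        by simp
      then have "(real j - real i) * (y (\<pi> i) - y (\<pi> j)) \<le> 0"
        by (simp add: algebra_simps)
      then show False using gt ij(1) by (simp add: mult_le_0_iff)
    qed
    then have "x \<in> sorted_roots ps" by (auto simp: sorted_roots_def x_def)
    moreover have "root_poly ps x = p"
    proof -
      have "root_poly ps x = (\<Prod>i<?t. [:- y (\<pi> i), 1:] ^ (ps ! \<pi> i))"
        unfolding root_poly_def using \<pi> by (intro prod.cong) (auto simp: x_def)
      also have "\<dots> = p"
        unfolding p root_poly_def using \<pi>
        by (intro prod.permute[symmetric, unfolded o_def, of \<pi> _ "\<lambda>i. [:- y i, 1:] ^ (ps ! i)"]) auto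
      finally show ?thesis .
    qed
    ultimately show "p \<in> root_poly ps ` sorted_roots ps" by blast
  qed
qed

subsection \<open>Topology of \<open>Hyp\<close>\<close>

lemma Euclidean_space_eq_top_of_set: "Euclidean_space n = top_of_set {x. \<forall>i\<ge>n. x i = 0}"
  by (simp add: Euclidean_space_def euclidean_product_topology)

lemma continuous_map_Euclidean_space_projection:
  "continuous_map (Euclidean_space n) euclideanreal (\<lambda>x. x i)"
  unfolding Euclidean_space_def
  by (intro continuous_map_from_subtopology continuous_map_product_projection) auto

text \<open>Tychonoff: \<open>C\<close> is a closed subset of a product of intervals, with singleton
  factors \<open>{0}\<close> in the coordinates from \<open>n\<close> on.\<close>

lemma compactin_Euclidean_space_bounded:
  assumes "closedin (Euclidean_space n) C" and bd: "\<And>x i. x \<in> C \<Longrightarrow> i < n \<Longrightarrow> \<bar>x i\<bar> \<le> B"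
  shows "compactin (Euclidean_space n) C"
proof -
  have C: "closed C" "C \<subseteq> {x. \<forall>i\<ge>n. x i = 0}"
    using assms(1) by (auto simp: closedin_Euclidean_space_iff topspace_Euclidean_space)
  define P where "P = (\<Pi>\<^sub>E i\<in>UNIV. if i < n then {- B..B} else {0})"
  have "compactin (powertop_real UNIV) P"
    unfolding P_def by (subst compactin_PiE) auto
  then have "compact P" by (simp add: euclidean_product_topology)
  moreover have "C \<subseteq> P"
    using C(2) bd unfolding P_def by (fastforce simp: abs_le_iff)
  ultimately have "compact C" using C(1) by (metis compact_Int_closed inf.absorb_iff2)
  then show ?thesis
    using C(2) by (simp add: Euclidean_space_eq_top_of_set compactin_subtopology)
qed

text \<open>Induction on \<open>n\<close> merges the bounds of the single coordinates by
  \<open>max\<close>. The sign of \<open>B\<close> is recorded for the root estimate.\<close>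

lemma compactin_real_map_bounded:
  fixes n :: nat
  assumes "compactin X K" "\<And>i. i < n \<Longrightarrow> continuous_map X euclideanreal (\<lambda>x. f x i)"
  shows "\<exists>B\<ge>0. \<forall>x\<in>K. \<forall>i<n. \<bar>f x i\<bar> \<le> B"
  using assms(2)
proof (induction n)
  case (Suc n)
  then obtain B where B: "B \<ge> 0" "\<forall>x\<in>K. \<forall>i<n. \<bar>f x i\<bar> \<le> B" by auto
  have "compact ((\<lambda>x. f x n) ` K)"
    using image_compactin[OF assms(1) Suc.prems[of n]] by simp
  then obtain b where "\<forall>x\<in>K. \<bar>f x n\<bar> \<le> b"
    by (metis compact_imp_bounded bounded_iff imageI real_norm_def)
  then show ?case
    using B by (intro exI[of _ "max B b"]) (auto simp: less_Suc_eq le_max_iff_disj)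
qed (use order_refl in auto)

text \<open>If the absolute value of \<open>r\<close> exceeds 1, isolating the leading term at
  \<open>r\<close> bounds \<open>\<bar>r\<bar> ^ d\<close> by
  \<open>d * B * \<bar>r\<bar> ^ (d - 1)\<close>, where \<open>d\<close> is the degree, and a power
  cancels. Otherwise the summand 1 suffices.\<close>

lemma abs_root_le_of_monic:
  fixes p :: "real poly" and r B :: real
  assumes "lead_coeff p = 1" "\<And>i. i < degree p \<Longrightarrow> \<bar>coeff p i\<bar> \<le> B" "poly p r = 0" "B \<ge> 0"
  shows "\<bar>r\<bar> \<le> 1 + degree p * B"
proof (cases "\<bar>r\<bar> \<le> 1")
  case True
  then show ?thesis using assms(4) by (simp add: add_increasing2)
next
  case False
  \<comment> \<open>A monic constant is 1 and has no root.\<close>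
  have "degree p \<noteq> 0"
  proof
    assume "degree p = 0"
    then obtain c where "p = [:c:]" by (rule degree_eq_zeroE)
    then show False using assms(1,3) by simp
  qed
  then obtain m where m: "degree p = Suc m" using not0_implies_Suc by blast
  have "0 = (\<Sum>i\<le>Suc m. coeff p i * r ^ i)" using assms(3) by (simp add: poly_altdef m)
  then have "r ^ Suc m = - (\<Sum>i<Suc m. coeff p i * r ^ i)"
    using assms(1) m by (simp add: lessThan_Suc_atMost)
  then have "\<bar>r\<bar> ^ Suc m = \<bar>\<Sum>i<Suc m. coeff p i * r ^ i\<bar>"
    by (metis abs_minus_cancel power_abs)
  also have "\<dots> \<le> (\<Sum>i<Suc m. \<bar>coeff p i * r ^ i\<bar>)" by (rule sum_abs)
  also have "\<dots> \<le> (\<Sum>i<Suc m. B * \<bar>r\<bar> ^ m)"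
  proof (rule sum_mono)
    fix i assume i: "i \<in> {..<Suc m}"
    have "\<bar>r\<bar> ^ i \<le> \<bar>r\<bar> ^ m" using i False by (intro power_increasing) auto
    then show "\<bar>coeff p i * r ^ i\<bar> \<le> B * \<bar>r\<bar> ^ m"
      unfolding abs_mult power_abs using assms(2,4) i m by (intro mult_mono) auto
  qed
  also have "\<dots> = (degree p * B) * \<bar>r\<bar> ^ m" by (simp add: m)
  finally have "\<bar>r\<bar> * \<bar>r\<bar> ^ m \<le> (degree p * B) * \<bar>r\<bar> ^ m" by simp
  then have "\<bar>r\<bar> \<le> degree p * B" using False by (simp add: mult_le_cancel_right)
  then show ?thesis by simp
qed

section \<open>Continuity of coefficients and metrizability of \<open>Hyp\<close>\<close>

lemma continuous_map_coeff_prod: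
  fixes f :: "'i \<Rightarrow> 'a \<Rightarrow> real poly"
  assumes "\<And>i k. i \<in> A \<Longrightarrow> continuous_map X euclideanreal (\<lambda>x. coeff (f i x) k)"
  shows "continuous_map X euclideanreal (\<lambda>x. coeff (\<Prod>i\<in>A. f i x) k)"
  using assms
proof (induction A arbitrary: k rule: infinite_finite_induct)
  case (insert i A)
  then show ?case
    by (simp add: coeff_mult) (intro continuous_intros insert.prems; simp)
qed auto

lemma continuous_map_coeff_power:
  fixes f :: "'a \<Rightarrow> real poly"
  assumes "\<And>k. continuous_map X euclideanreal (\<lambda>x. coeff (f x) k)"
  shows "continuous_map X euclideanreal (\<lambda>x. coeff (f x ^ m) k)"
  using continuous_map_coeff_prod[of "{..<m}" X "\<lambda>_. f" k] assms by simp

lemma continuous_map_coeff_vector: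
  "continuous_map (Hyp_topology n ps) (Euclidean_space n) (coeff_vector n)"
  using continuous_map_pullback[OF continuous_map_id, of "Hyp ps" "coeff_vector n" "Euclidean_space n"]
  by (simp add: Hyp_topology_def)

text \<open>Open sets of the pullback topology are preimages of open sets, so the injective
  coefficient map is open onto its image. Metrizability of \<open>Hyp_topology\<close> then comes
  from Euclidean space.\<close>

lemma homeomorphic_space_Hyp_topology:
  assumes "sum_list ps = n"
  shows "Hyp_topology n ps homeomorphic_space
    subtopology (Euclidean_space n) (coeff_vector n ` Hyp ps)"
proof -
  let ?Y = "subtopology (Euclidean_space n) (coeff_vector n ` Hyp ps)"
  have sub: "coeff_vector n ` Hyp ps \<subseteq> topspace (Euclidean_space n)"
    by (auto simp: topspace_Euclidean_space coeff_vector_def)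
  have inj: "inj_on (coeff_vector n) (Hyp ps)" by (rule inj_on_coeff_vector[OF assms])
  have "homeomorphic_map (Hyp_topology n ps) ?Y (coeff_vector n)"
  proof (rule bijective_open_imp_homeomorphic_map)
    show "continuous_map (Hyp_topology n ps) ?Y (coeff_vector n)"
      using continuous_map_coeff_vector by (auto simp: continuous_map_in_subtopology)
    show "open_map (Hyp_topology n ps) ?Y (coeff_vector n)"
      unfolding open_map_def Hyp_topology_def openin_pullback_topology openin_subtopology by blast
  qed (use sub inj in auto)
  then show ?thesis using homeomorphic_map_imp_homeomorphic_space by blast
qed

lemma metrizable_space_Hyp_topology:
  "sum_list ps = n \<Longrightarrow> metrizable_space (Hyp_topology n ps)"
  using homeomorphic_space_Hyp_topology homeomorphic_metrizable_space
    metrizable_Euclidean_space metrizable_space_subtopology by blast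

section \<open>The cone of sorted root vectors\<close>

definition sorted_roots_topology :: "nat list \<Rightarrow> (nat \<Rightarrow> real) topology" where
  "sorted_roots_topology ps = subtopology (Euclidean_space (length ps)) (sorted_roots ps)"

lemma topspace_sorted_roots_topology [simp]:
  "topspace (sorted_roots_topology ps) = sorted_roots ps"
  by (auto simp: sorted_roots_topology_def topspace_Euclidean_space sorted_roots_def)

text \<open>The complement is a union of open half-spaces \<open>x i > x j\<close>, one for each
  pair \<open>i < j\<close> of indices of equal parts.\<close>

lemma closedin_sorted_roots: "closedin (Euclidean_space (length ps)) (sorted_roots ps)"
proof -
  let ?E = "Euclidean_space (length ps)"
  let ?A = "{(i,j). i < j \<and> j < length ps \<and> ps ! i = ps ! j}"
  have eq: "sorted_roots ps = topspace ?E - (\<Union>(i,j)\<in>?A. {x \<in> topspace ?E. x i - x j \<in> {0<..}})"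
    by (auto simp: sorted_roots_def topspace_Euclidean_space) fastforce
  have "openin ?E {x \<in> topspace ?E. x i - x j \<in> {0<..}}" for i j
    by (intro openin_continuous_map_preimage[where Y=euclideanreal] continuous_intros
        continuous_map_Euclidean_space_projection) auto
  then have "openin ?E (\<Union>(i,j)\<in>?A. {x \<in> topspace ?E. x i - x j \<in> {0<..}})"
    by (intro openin_Union) auto
  then show ?thesis
    unfolding eq by (rule closedin_diff[OF closedin_topspace])
qed

text \<open>A closed subset of the cone is closed in Euclidean space because the cone is, so
  boundedness suffices for compactness.\<close>

lemma compactin_sorted_roots_bounded:
  assumes "closedin (sorted_roots_topology ps) C" and "\<And>x i. x \<in> C \<Longrightarrow> i < length ps \<Longrightarrow> \<bar>x i\<bar> \<le> B"
  shows "compactin (sorted_roots_topology ps) C"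
proof -
  have "closedin (Euclidean_space (length ps)) C"
    using assms(1) closedin_sorted_roots unfolding sorted_roots_topology_def
    by (rule closedin_trans_full)
  moreover have "C \<subseteq> sorted_roots ps"
    using closedin_subset[OF assms(1)] by simp
  ultimately show ?thesis
    using compactin_Euclidean_space_bounded[of "length ps" C B] assms(2)
    by (auto simp: sorted_roots_topology_def compactin_subtopology)
qed

text \<open>A continuous bijection that is closed because it is proper. Properness holds as
  coefficients in a compact set are bounded, hence so are all the roots.\<close>

lemma homeomorphic_map_root_poly:
  assumes res: "free_of_resonances ps" and pos: "\<forall>p\<in>set ps. 1 \<le> p" and sum: "sum_list ps = n"
  shows "homeomorphic_map (sorted_roots_topology ps) (Hyp_topology n ps) (root_poly ps)"
proof -
  let ?W = "sorted_roots_topology ps" and ?H = "Hyp_topology n ps"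
  have metr: "metrizable_space ?H" using metrizable_space_Hyp_topology[OF sum] .
  have proj: "continuous_map ?W euclideanreal (\<lambda>x. x i)" for i
    unfolding sorted_roots_topology_def
    by (intro continuous_map_from_subtopology continuous_map_Euclidean_space_projection)
  have lin: "continuous_map ?W euclideanreal (\<lambda>x. coeff [:- x i, 1:] k)" for i k
  proof (cases k)
    case 0
    then show ?thesis using proj by (auto intro!: continuous_intros)
  qed (auto simp: coeff_pCons)
  have "continuous_map ?W (Euclidean_space n) (\<lambda>x. coeff_vector n (root_poly ps x))"
    unfolding coeff_vector_def root_poly_def continuous_map_componentwise_Euclidean_space
    by (intro allI impI continuous_map_coeff_prod continuous_map_coeff_power lin)
  then have cont: "continuous_map ?W ?H (root_poly ps)"
    unfolding Hyp_topology_def using root_poly_sorted_roots[of ps]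
    by (intro continuous_map_pullback') (auto simp: o_def)
  have coeff: "continuous_map ?H euclideanreal (\<lambda>p. coeff_vector n p i)" for i
    using continuous_map_compose[OF continuous_map_coeff_vector continuous_map_Euclidean_space_projection]
    by (simp add: o_def)
  have "proper_map ?W ?H (root_poly ps)"
  \<comment> \<open>Metrizability makes the target a Hausdorff k-space, where compactness of the
    preimages of compact sets is enough for a continuous map to be proper.\<close>
  proof (rule compact_imp_proper_map)
    show "k_space ?H" "kc_space ?H"
      using metr metrizable_imp_k_space metrizable_imp_Hausdorff_space Hausdorff_imp_kc_space by blast+
    show "root_poly ps \<in> topspace ?W \<rightarrow> topspace ?H"
      using cont by (simp add: continuous_map_def)
    show "continuous_map ?W ?H (root_poly ps) \<or> kc_space ?W" using cont by blast
    fix K assume K: "compactin ?H K"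
    obtain B where B: "B \<ge> 0" "\<forall>p\<in>K. \<forall>i<n. \<bar>coeff_vector n p i\<bar> \<le> B"
      using compactin_real_map_bounded[OF K, of n "coeff_vector n"] coeff by auto
    show "compactin ?W {x \<in> topspace ?W. root_poly ps x \<in> K}"
    proof (rule compactin_sorted_roots_bounded)
      have "closedin ?H K"
        using K metr by (meson compactin_imp_closedin metrizable_imp_Hausdorff_space)
      then show "closedin ?W {x \<in> topspace ?W. root_poly ps x \<in> K}"
        using cont closedin_continuous_map_preimage by blast
      fix x i assume x: "x \<in> {x \<in> topspace ?W. root_poly ps x \<in> K}" and i: "i < length ps"
      then have H: "root_poly ps x \<in> Hyp ps" using root_poly_sorted_roots[of ps] by auto
      note d = Hyp_monic_degree[OF H]
      have "\<bar>x i\<bar> \<le> 1 + degree (root_poly ps x) * B"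
      proof (rule abs_root_le_of_monic)
        show "\<bar>coeff (root_poly ps x) k\<bar> \<le> B" if "k < degree (root_poly ps x)" for k
          using B x that d sum by (auto simp: coeff_vector_def)
        \<comment> \<open>A part of size 0 would contribute the factor 1, and \<open>x i\<close>
          need not then be a root.\<close>
        have "ps ! i \<noteq> 0" using i pos nth_mem by fastforce
        then show "poly (root_poly ps x) (x i) = 0"
          unfolding root_poly_def poly_prod using i
          by (intro prod_zero bexI[of _ i]) (auto simp: poly_power)
      qed (use d B in auto)
      then show "\<bar>x i\<bar> \<le> 1 + n * B" using d sum by simp
    qed
  qed
  then show ?thesis
    using cont inj_on_root_poly[OF res pos] root_poly_sorted_roots[of ps]
    by (intro bijective_closed_imp_homeomorphic_map) (auto simp: proper_imp_closed_map)
qed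

subsection \<open>One-point compactifications\<close>

text \<open>An open set around the added point is the complement of a closed compact
  \<open>K\<close>. Its preimage is the complement of the preimage of \<open>K\<close> in
  \<open>G\<close>, hence open by \<open>proper\<close>, since everything outside \<open>G\<close>
  is sent to the added point.\<close>

lemma continuous_map_into_Alexandroff_compactification:
  assumes G: "openin Z G" and f: "continuous_map (subtopology Z G) X f"
    and proper: "\<And>K. compactin X K \<Longrightarrow> closedin X K \<Longrightarrow> closedin Z {z\<in>G. f z \<in> K}"
  shows "continuous_map Z (Alexandroff_compactification X) (\<lambda>z. if z \<in> G then Some (f z) else None)"
    (is "continuous_map Z ?A ?h")
proof -
  have OZ: "G \<subseteq> topspace Z" using G by (rule openin_subset)
  then have topO: "topspace (subtopology Z G) = G" by auto
  have fO: "f z \<in> topspace X" if "z \<in> G" for z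
    using f that topO by (auto simp: continuous_map_def)
  show ?thesis
    unfolding continuous_map_def
  proof (intro conjI allI impI)
    show "?h \<in> topspace Z \<rightarrow> topspace ?A" using fO by auto
    fix U assume "openin ?A U"
    then consider V where "openin X V" "U = Some ` V"
      | C where "compactin X C" "closedin X C" "U = insert None (Some ` (topspace X - C))"
      by (auto simp: openin_Alexandroff_compactification)
    then show "openin Z {z \<in> topspace Z. ?h z \<in> U}"
    proof cases
      case 1
      have "openin (subtopology Z G) {z \<in> topspace (subtopology Z G). f z \<in> V}"
        using f 1(1) by (rule openin_continuous_map_preimage)
      then have "openin Z {z \<in> G. f z \<in> V}"
        using G topO by (metis openin_trans_full)
      moreover have "{z \<in> topspace Z. ?h z \<in> U} = {z \<in> G. f z \<in> V}"
        using OZ by (auto simp: 1)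
      ultimately show ?thesis by simp
    next
      case 2
      have "{z \<in> topspace Z. ?h z \<in> U} = topspace Z - {z\<in>G. f z \<in> C}"
        using OZ fO by (auto simp: 2)
      then show ?thesis using proper[OF 2(1,2)] by (simp add: closedin_def)
    qed
  qed
qed

text \<open>A homeomorphism pulls closed compact sets back to closed compact sets, so it extends by
  sending the added point to the added point.\<close>

lemma continuous_map_map_option_Alexandroff:
  assumes "homeomorphic_map X Y f"
  shows "continuous_map (Alexandroff_compactification X) (Alexandroff_compactification Y) (map_option f)"
proof -
  let ?Z = "Alexandroff_compactification X" and ?G = "Some ` topspace X"
  obtain g where g: "homeomorphic_maps X Y f g" using assms homeomorphic_map_maps by blast
  obtain s where s: "homeomorphic_maps X (subtopology ?Z ?G) Some s"
    using embedding_map_Some[of X] unfolding embedding_map_def homeomorphic_map_maps by blast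
  have s_Some: "s (Some x) = x" if "x \<in> topspace X" for x
    using s that by (simp add: homeomorphic_maps_def)
  have gf: "g (f x) = x" if "x \<in> topspace X" for x
    using g that by (simp add: homeomorphic_maps_def)
  have fg: "f (g y) = y" and gX: "g y \<in> topspace X" if "y \<in> topspace Y" for y
    using g that by (auto simp: homeomorphic_maps_def dest: continuous_map_funspace)
  have "continuous_map ?Z (Alexandroff_compactification Y) (\<lambda>z. if z \<in> ?G then Some ((f \<circ> s) z) else None)"
  proof (rule continuous_map_into_Alexandroff_compactification)
    show "continuous_map (subtopology ?Z ?G) Y (f \<circ> s)"
      using s g unfolding homeomorphic_maps_def by (blast intro: continuous_map_compose)
    fix K assume K: "compactin Y K" "closedin Y K"
    have "K \<subseteq> topspace Y" using K by (simp add: closedin_subset)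
    have "{z \<in> ?G. (f \<circ> s) z \<in> K} = Some ` {x \<in> topspace X. f x \<in> K}"
      by (auto simp: s_Some)
    moreover have "{x \<in> topspace X. f x \<in> K} = g ` K"
    proof
      show "{x \<in> topspace X. f x \<in> K} \<subseteq> g ` K"
        using gf by (auto intro: image_eqI[OF sym])
      show "g ` K \<subseteq> {x \<in> topspace X. f x \<in> K}"
        using \<open>K \<subseteq> topspace Y\<close> fg gX by (auto dest!: subsetD)
    qed
    moreover have "homeomorphic_map Y X g" using g homeomorphic_maps_map by blast
    then have "compactin X (g ` K)" "closedin X (g ` K)"
      using K \<open>K \<subseteq> topspace Y\<close> homeomorphic_map_compactness homeomorphic_map_closedness by blast+
    ultimately show "closedin ?Z {z \<in> ?G. (f \<circ> s) z \<in> K}" by simp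
  qed simp
  then show ?thesis
    by (rule continuous_map_eq) (auto simp: s_Some)
qed

lemma homeomorphic_space_Alexandroff_compactification:
  assumes "X homeomorphic_space Y"
  shows "Alexandroff_compactification X homeomorphic_space Alexandroff_compactification Y"
proof -
  obtain f g where fg: "homeomorphic_maps X Y f g" using assms by (auto simp: homeomorphic_space_def)
  then have "homeomorphic_maps (Alexandroff_compactification X) (Alexandroff_compactification Y)
      (map_option f) (map_option g)"
    using continuous_map_map_option_Alexandroff[of X Y f] continuous_map_map_option_Alexandroff[of Y X g]
      homeomorphic_maps_map[of X Y f g]
    by (auto simp: homeomorphic_maps_def)
  then show ?thesis by (auto simp: homeomorphic_space_def)
qed

section \<open>Contracting to the added point\<close>

text \<open>Rescaling time from \<open>[0, \<infinity>)\<close> to \<open>[0, 1)\<close> leaves the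
  end time 1 for the constant map to the added point. Continuity there, and at the added point at
  every time, is the joint properness of \<open>\<phi>\<close> in time and space.\<close>

lemma contractible_Alexandroff_compactification:
  fixes \<phi> :: "real \<Rightarrow> 'a \<Rightarrow> 'a"
  assumes loc: "locally_compact_space X" and Haus: "Hausdorff_space X"
    and cont: "continuous_map (prod_topology (top_of_set {0..}) X) X (\<lambda>(s,x). \<phi> s x)"
    and zero: "\<And>x. x \<in> topspace X \<Longrightarrow> \<phi> 0 x = x"
    and proper: "\<And>K. compactin X K \<Longrightarrow> closedin X K \<Longrightarrow>
       compactin (prod_topology (top_of_set {0..}) X) {(s,x). 0 \<le> s \<and> x \<in> topspace X \<and> \<phi> s x \<in> K}"
  shows "contractible_space (Alexandroff_compactification X)"
proof -
  let ?A = "Alexandroff_compactification X" and ?I = "top_of_set {0..1::real}" and ?R = "top_of_set {0::real..}"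
  let ?Z = "prod_topology ?I ?A"
  let ?G = "{0..<1::real} \<times> Some ` topspace X"
  obtain g where g: "homeomorphic_maps X (subtopology ?A (Some ` topspace X)) Some g"
    using embedding_map_Some[of X] unfolding embedding_map_def homeomorphic_map_maps by blast
  have g_Some: "g (Some x) = x" if "x \<in> topspace X" for x
    using g that by (simp add: homeomorphic_maps_def)
  let ?h = "\<lambda>z. if z \<in> ?G then Some ((\<lambda>(s,a). \<phi> (s / (1 - s)) (g a)) z) else None"
  have "continuous_map ?Z ?A ?h"
  proof (rule continuous_map_into_Alexandroff_compactification)
    have "openin ?I {0..<1}"
      by (auto simp: openin_open intro!: exI[of _ "{..<1}"])
    then show "openin ?Z ?G" by (simp add: openin_prod_Times_iff)
    have sub: "subtopology ?Z ?G = prod_topology (top_of_set {0..<1}) (subtopology ?A (Some ` topspace X))"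
    proof -
      have "{0..1} \<inter> {0..<1} = {0..<1::real}" by auto
      then show ?thesis
        by (simp add: prod_topology_subtopology subtopology_subtopology Times_Int_Times)
    qed
    have 1: "continuous_map (subtopology ?Z ?G) ?R (\<lambda>z. fst z / (1 - fst z))"
      unfolding sub
      by (auto simp: continuous_map_in_subtopology intro!: continuous_map_real_divide continuous_intros
          continuous_map_into_fulltopology[OF continuous_map_fst])
    have 2: "continuous_map (subtopology ?Z ?G) X (\<lambda>z. g (snd z))"
      unfolding sub using g by (intro continuous_map_compose[OF continuous_map_snd, unfolded o_def])
        (auto simp: homeomorphic_maps_def)
    have "continuous_map (subtopology ?Z ?G) X ((\<lambda>(s,x). \<phi> s x) \<circ> (\<lambda>z. (fst z / (1 - fst z), g (snd z))))"
      using 1 2 cont by (intro continuous_map_compose[OF _ cont]) (simp add: continuous_map_pairedI)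
    then show "continuous_map (subtopology ?Z ?G) X (\<lambda>(s,a). \<phi> (s / (1 - s)) (g a))"
      by (simp add: o_def case_prod_unfold)
    fix K assume K: "compactin X K" "closedin X K"
    let ?P = "{(s,x). 0 \<le> s \<and> x \<in> topspace X \<and> \<phi> s x \<in> K}"
    \<comment> \<open>\<open>s / (1 + s)\<close> inverts the time change \<open>s / (1 - s)\<close>.
      So the set to be shown closed is the image of the compact \<open>?P\<close>, and compact sets
      are closed in a Hausdorff space.\<close>
    let ?q = "\<lambda>(s::real, x). (s / (1 + s), Some x)"
    have "continuous_map (prod_topology ?R X) ?I (\<lambda>z. fst z / (1 + fst z))"
      by (auto simp: continuous_map_in_subtopology intro!: continuous_map_real_divide continuous_intros
          continuous_map_into_fulltopology[OF continuous_map_fst])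
    moreover have "continuous_map (prod_topology ?R X) ?A (\<lambda>z. Some (snd z))"
      using continuous_map_compose[OF continuous_map_snd continuous_map_Some] by (simp add: o_def)
    ultimately have "continuous_map (prod_topology ?R X) ?Z ?q"
      by (simp add: case_prod_unfold continuous_map_pairedI)
    then have "compactin ?Z (?q ` ?P)" using proper[OF K] image_compactin by blast
    moreover have "Hausdorff_space ?Z"
      by (simp add: Hausdorff_space_prod_topology Hausdorff_space_Alexandroff_compactification loc Haus Hausdorff_space_subtopology)
    ultimately have "closedin ?Z (?q ` ?P)" using compactin_imp_closedin by blast
    moreover have "?q ` ?P = {z \<in> ?G. (\<lambda>(s,a). \<phi> (s / (1 - s)) (g a)) z \<in> K}" (is "_ = ?Q")
    proof
      show "?q ` ?P \<subseteq> ?Q"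
      proof
        fix z assume "z \<in> ?q ` ?P"
        then obtain s x where z: "z = (s / (1 + s), Some x)"
          and *: "0 \<le> s" "x \<in> topspace X" "\<phi> s x \<in> K" by auto
        have "s / (1 + s) / (1 - s / (1 + s)) = s" using *(1) by (simp add: field_simps)
        with * show "z \<in> ?Q" by (simp add: z g_Some)
      qed
      show "?Q \<subseteq> ?q ` ?P"
      proof
        fix z assume "z \<in> ?Q"
        then obtain s x where z: "z = (s, Some x)"
          and *: "s \<in> {0..<1}" "x \<in> topspace X" "\<phi> (s / (1 - s)) (g (Some x)) \<in> K" by auto
        have "s / (1 - s) / (1 + s / (1 - s)) = s" using *(1) by (simp add: field_simps)
        with * show "z \<in> ?q ` ?P" unfolding z
          by (intro image_eqI[of _ _ "(s / (1 - s), x)"]) (auto simp: g_Some)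
      qed
    qed
    ultimately show "closedin ?Z {z \<in> ?G. (\<lambda>(s,a). \<phi> (s / (1 - s)) (g a)) z \<in> K}" by simp
  qed
  \<comment> \<open>At time 0 the homotopy is the identity by \<open>zero\<close>; time 1 lies
    outside \<open>?G\<close>, which gives the constant map.\<close>
  then have "homotopic_with (\<lambda>_. True) ?A ?A id (\<lambda>_. None)"
    by (subst homotopic_with) (auto simp: g_Some zero intro!: exI[of _ ?h])
  then show ?thesis unfolding contractible_space_def by blast
qed

section \<open>Spheres as compactified Euclidean spaces\<close>

lemma Hausdorff_space_nsphere: "Hausdorff_space (nsphere n)"
  by (simp add: nsphere_def Hausdorff_space_subtopology Hausdorff_Euclidean_space)

lemma compact_space_nsphere: "compact_space (nsphere n)"
proof -
  let ?E = "Euclidean_space (Suc n)" and ?C = "{x \<in> topspace (Euclidean_space (Suc n)). (\<Sum>i\<le>n. (x i)\<^sup>2) \<in> {1::real}}"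
  have "closedin ?E ?C"
    by (intro closedin_continuous_map_preimage[where Y=euclideanreal] continuous_intros
        continuous_map_Euclidean_space_projection) auto
  moreover have "\<bar>x i\<bar> \<le> 1" if "x \<in> ?C" "i < Suc n" for x i
  proof -
    have "(x i)\<^sup>2 \<le> (\<Sum>i\<le>n. (x i)\<^sup>2)" using that by (intro member_le_sum) auto
    then show ?thesis using that by (simp add: abs_square_le_1)
  qed
  ultimately have "compactin ?E ?C" by (rule compactin_Euclidean_space_bounded)
  moreover have "?C = topspace ?E \<inter> {x. (\<Sum>i\<le>n. (x i)\<^sup>2) = 1}" by auto
  then have "nsphere n = subtopology ?E ?C"
    by (simp only: nsphere_def subtopology_restrict)
  ultimately show ?thesis by (simp add: compact_space_subtopology)
qed

text \<open>Stereographic projection \<open>f\<close> from the pole with last coordinate 1, with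
  inverse \<open>q\<close>; the pole goes to the added point. A continuous bijection from a compact
  space to a Hausdorff space is a homeomorphism.\<close>

lemma Alexandroff_compactification_Euclidean_space:
  "Alexandroff_compactification (Euclidean_space t) homeomorphic_space nsphere t"
proof -
  let ?E = "Euclidean_space t" and ?S = "nsphere t"
  define N :: "(nat \<Rightarrow> real) \<Rightarrow> real" where "N = (\<lambda>y. \<Sum>i<t. (y i)\<^sup>2)"
  define f :: "(nat \<Rightarrow> real) \<Rightarrow> nat \<Rightarrow> real" where "f = (\<lambda>x i. if i < t then x i / (1 - x t) else 0)"
  \<comment> \<open>The outer conditional up to \<open>Suc t\<close> is kept so that the
    componentwise criterion for continuity into \<open>Euclidean_space (Suc t)\<close> applies
    verbatim.\<close>
  define q :: "(nat \<Rightarrow> real) \<Rightarrow> nat \<Rightarrow> real" where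
    "q = (\<lambda>y i. if i < Suc t then if i < t then 2 * y i / (1 + N y) else (N y - 1) / (1 + N y) else 0)"
  define G where "G = {x \<in> topspace ?S. x t \<in> - {1}}"
  have S: "x \<in> topspace ?S \<longleftrightarrow> N x + (x t)\<^sup>2 = 1 \<and> (\<forall>i>t. x i = 0)" for x
    by (auto simp: nsphere N_def lessThan_Suc_atMost[symmetric])
  have N: "N y = (\<Sum>i<t. (y i)\<^sup>2)" for y by (simp add: N_def)
  have N0: "N y \<ge> 0" for y by (simp add: N_def sum_nonneg)
  then have N1: "1 + N y \<noteq> 0" for y by (smt (verit))
  have Nscale: "(\<Sum>i<t. c * (y i)\<^sup>2) = c * N y" for c y
    by (simp add: N_def sum_distrib_left)
  have Nq: "N (q y) = 4 * N y / (1 + N y)\<^sup>2" for y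
  proof -
    have "N (q y) = (\<Sum>i<t. 4 / (1 + N y)\<^sup>2 * (y i)\<^sup>2)"
      unfolding N[of "q y"] by (intro sum.cong) (auto simp: q_def power_divide power_mult_distrib)
    then show ?thesis unfolding Nscale by simp
  qed
  have Nf: "N (f x) = N x / (1 - x t)\<^sup>2" for x
  proof -
    have "N (f x) = (\<Sum>i<t. 1 / (1 - x t)\<^sup>2 * (x i)\<^sup>2)"
      unfolding N[of "f x"] by (intro sum.cong) (auto simp: f_def power_divide)
    then show ?thesis unfolding Nscale by simp
  qed
  have contE: "continuous_map ?E euclideanreal (\<lambda>y. y i)" for i
    by (rule continuous_map_Euclidean_space_projection)
  have contN: "continuous_map ?E euclideanreal N"
    unfolding N_def by (intro continuous_map_sum continuous_map_real_pow contE) auto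
  have qS: "q y \<in> topspace ?S" for y
  proof -
    \<comment> \<open>The squared norm of \<open>q y\<close> in terms of \<open>a = N y\<close>: the
      numerators \<open>4 * a\<close> and \<open>(a - 1)\<^sup>2\<close> add up to
      \<open>(1 + a)\<^sup>2\<close>.\<close>
    have "4 * a / (1 + a)\<^sup>2 + ((a - 1) / (1 + a))\<^sup>2 = 1" if "1 + a \<noteq> 0" for a :: real
    proof -
      have "4 * a + (a - 1)\<^sup>2 = (1 + a)\<^sup>2" by (simp add: power2_eq_square algebra_simps)
      then show ?thesis using that by (simp add: power_divide flip: add_divide_distrib)
    qed
    note this[OF N1[of y]]
    then show ?thesis by (simp add: S Nq) (simp add: q_def)
  qed
  have qG: "q y \<in> G" for y
    using qS N1[of y] by (auto simp: G_def q_def field_simps)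
  have fq: "f (q y) = y" if "y \<in> topspace ?E" for y
  proof
    fix i
    have "1 - (N y - 1) / (1 + N y) = 2 / (1 + N y)" using N1[of y] by (simp add: field_simps)
    then show "f (q y) i = y i"
      using that N1[of y] by (auto simp: f_def q_def topspace_Euclidean_space)
  qed
  have qf: "q (f x) = x" if x: "x \<in> G" for x
  proof
    fix i
    have ne: "1 - x t \<noteq> 0" using x by (simp add: G_def)
    \<comment> \<open>The sphere equation, factored; it cancels one factor \<open>1 - x t\<close> in
      \<open>N (f x)\<close>.\<close>
    have "N x = (1 - x t) * (1 + x t)"
      using x by (simp add: G_def S power2_eq_square algebra_simps)
    then have Nfx: "N (f x) = (1 + x t) / (1 - x t)"
      using ne by (simp add: Nf power2_eq_square)
    then have *: "1 + N (f x) = 2 / (1 - x t)" "N (f x) - 1 = 2 * x t / (1 - x t)"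
      using ne by (simp_all add: field_simps)
    show "q (f x) i = x i"
      unfolding q_def * using x ne by (auto simp: f_def G_def S not_less less_Suc_eq)
  qed
  have contq: "continuous_map ?E ?S q"
  proof -
    have "continuous_map ?E (Euclidean_space (Suc t)) q"
      unfolding q_def continuous_map_componentwise_Euclidean_space
    proof (intro allI impI)
      fix i
      show "continuous_map ?E euclideanreal
          (\<lambda>y. if i < t then 2 * y i / (1 + N y) else (N y - 1) / (1 + N y))"
        using N1 by (cases "i < t") (auto intro!: continuous_map_real_divide continuous_intros contE contN)
    qed
    then show ?thesis
      using qS unfolding nsphere_def by (auto simp: continuous_map_in_subtopology)
  qed
  have contG: "continuous_map (subtopology ?S G) euclideanreal (\<lambda>x. x i)" for i
    by (intro continuous_map_from_subtopology continuous_map_nsphere_projection)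
  have contf: "continuous_map (subtopology ?S G) ?E f"
    unfolding f_def continuous_map_componentwise_Euclidean_space
    by (intro allI impI continuous_map_real_divide continuous_map_diff contG) (auto simp: G_def)
  have "continuous_map ?S (Alexandroff_compactification ?E) (\<lambda>x. if x \<in> G then Some (f x) else None)"
  proof (rule continuous_map_into_Alexandroff_compactification[OF _ contf])
    show "openin ?S G"
      unfolding G_def by (intro openin_continuous_map_preimage[where Y=euclideanreal]
          continuous_map_nsphere_projection) auto
    fix K assume K: "compactin ?E K"
    have "K \<subseteq> topspace ?E" using K by (rule compactin_subset_topspace)
    \<comment> \<open>Since \<open>q\<close> inverts \<open>f\<close> on \<open>G\<close>, the
      preimage of \<open>K\<close> is a continuous image of a compact set.\<close>
    then have "{x \<in> G. f x \<in> K} = q ` K"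
      using fq qf qG by (force simp: image_iff)
    moreover have "compactin ?S (q ` K)" using image_compactin[OF K contq] .
    ultimately show "closedin ?S {x \<in> G. f x \<in> K}"
      using compactin_imp_closedin[OF Hausdorff_space_nsphere] by simp
  qed
  then have "homeomorphic_map ?S (Alexandroff_compactification ?E) (\<lambda>x. if x \<in> G then Some (f x) else None)"
  proof (rule continuous_imp_homeomorphic_map[OF _ compact_space_nsphere])
    show "Hausdorff_space (Alexandroff_compactification ?E)"
      by (simp add: Hausdorff_space_Alexandroff_compactification Hausdorff_Euclidean_space locally_compact_Euclidean_space)
    have fE: "f x \<in> topspace ?E" for x by (simp add: f_def topspace_Euclidean_space)
    let ?pole = "\<lambda>i. if i = t then 1 else 0 :: real"
    have pole: "?pole \<in> topspace ?S - G" by (simp add: G_def S N_def)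
    have GS: "G \<subseteq> topspace ?S" by (auto simp: G_def)
    show "(\<lambda>x. if x \<in> G then Some (f x) else None) ` topspace ?S = topspace (Alexandroff_compactification ?E)"
    proof
      show "topspace (Alexandroff_compactification ?E) \<subseteq> (\<lambda>x. if x \<in> G then Some (f x) else None) ` topspace ?S"
      proof
        fix z assume "z \<in> topspace (Alexandroff_compactification ?E)"
        then consider "z = None" | y where "y \<in> topspace ?E" "z = Some y" by auto
        then show "z \<in> (\<lambda>x. if x \<in> G then Some (f x) else None) ` topspace ?S"
        proof cases
          case 1
          then show ?thesis using pole by (intro image_eqI[of _ _ ?pole]) auto
        next
          case 2
          then show ?thesis using qG qS fq by (intro image_eqI[of _ _ "q y"]) auto
        qed
      qed
    qed (use fE in auto)
    \<comment> \<open>A last coordinate 1 uses up the whole norm, so the other coordinates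
      vanish.\<close>
    have unique: "x = ?pole" if "x \<in> topspace ?S" "x \<notin> G" for x
    proof
      fix i
      have "x t = 1" "N x = 0" "\<forall>i>t. x i = 0" using that by (auto simp: G_def S)
      moreover from this have "\<forall>i<t. x i = 0" by (simp add: N_def sum_nonneg_eq_0_iff)
      ultimately show "x i = ?pole i" by (cases i t rule: linorder_cases) auto
    qed
    show "inj_on (\<lambda>x. if x \<in> G then Some (f x) else None) (topspace ?S)"
    proof (rule inj_onI)
      fix x x' assume "x \<in> topspace ?S" "x' \<in> topspace ?S"
        "(if x \<in> G then Some (f x) else None) = (if x' \<in> G then Some (f x') else None)"
      then show "x = x'" using unique[of x] unique[of x'] qf by (metis option.distinct(1) option.inject)
    qed
  qed
  then show ?thesis using homeomorphic_map_imp_homeomorphic_space homeomorphic_space_sym by blast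
qed

text \<open>The pushed root is bounded below by another root of the same part, so a bounded set is hit
  only by bounded pushes of a bounded set of root vectors.\<close>
lemma contractible_Alexandroff_sorted_roots:
  assumes "\<not> distinct ps"
  shows "contractible_space (Alexandroff_compactification (sorted_roots_topology ps))"
proof -
  let ?t = "length ps" and ?W = "sorted_roots_topology ps"
  obtain i\<^sub>0 j\<^sub>1 where ij: "i\<^sub>0 < j\<^sub>1" "j\<^sub>1 < ?t" "ps ! i\<^sub>0 = ps ! j\<^sub>1"
    using assms unfolding distinct_conv_nth by (metis linorder_neqE_nat)
  \<comment> \<open>\<open>j\<close> is the last index of a block with at least two members: raising
    its root keeps the block sorted, and the root at \<open>i\<^sub>0\<close> stays put as a lower
    bound.\<close>
  define j where "j = Max {k. k < ?t \<and> ps ! k = ps ! i\<^sub>0}"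
  have "j \<in> {k. k < ?t \<and> ps ! k = ps ! i\<^sub>0}" unfolding j_def using ij by (intro Max_in) auto
  then have j: "j < ?t" "ps ! j = ps ! i\<^sub>0" by auto
  have jmax: "k \<le> j" if "k < ?t" "ps ! k = ps ! i\<^sub>0" for k
    unfolding j_def using that by (intro Max_ge) auto
  have i0j: "i\<^sub>0 < j" using ij jmax[of j\<^sub>1] by simp
  define \<phi> :: "real \<Rightarrow> (nat \<Rightarrow> real) \<Rightarrow> nat \<Rightarrow> real" where
    "\<phi> = (\<lambda>s x i. if i < ?t then x i + (if i = j then s else 0) else 0)"
  let ?R = "top_of_set {0::real..}"
  have \<phi>W: "\<phi> s x \<in> sorted_roots ps" if "0 \<le> s" "x \<in> sorted_roots ps" for s x
  proof -
    have "\<phi> s x k \<le> \<phi> s x l" if kl: "k < l" "l < ?t" "ps ! k = ps ! l" for k l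
    proof -
      have "k \<noteq> j" using jmax[of l] j kl by auto
      moreover have "x k \<le> x l" using kl \<open>x \<in> sorted_roots ps\<close> by (simp add: sorted_roots_def)
      ultimately show ?thesis using kl \<open>0 \<le> s\<close> by (auto simp: \<phi>_def)
    qed
    then show ?thesis by (auto simp: sorted_roots_def \<phi>_def)
  qed
  have projW: "continuous_map ?W euclideanreal (\<lambda>x. x i)" for i
    unfolding sorted_roots_topology_def
    by (intro continuous_map_from_subtopology continuous_map_Euclidean_space_projection)
  have proj: "continuous_map (prod_topology ?R ?W) euclideanreal (\<lambda>z. snd z i)" for i
    using continuous_map_compose[OF continuous_map_snd projW] by (simp add: o_def)
  have "continuous_map (prod_topology ?R ?W) (Euclidean_space ?t) (\<lambda>z. \<phi> (fst z) (snd z))"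
    unfolding \<phi>_def continuous_map_componentwise_Euclidean_space
    by (auto intro!: continuous_intros proj continuous_map_into_fulltopology[OF continuous_map_fst])
  then have cont: "continuous_map (prod_topology ?R ?W) ?W (\<lambda>(s,x). \<phi> s x)"
    using \<phi>W by (auto simp: sorted_roots_topology_def continuous_map_in_subtopology case_prod_unfold)
  have Haus: "Hausdorff_space ?W"
    by (simp add: sorted_roots_topology_def Hausdorff_space_subtopology Hausdorff_Euclidean_space)
  show ?thesis
  proof (rule contractible_Alexandroff_compactification[OF _ Haus cont])
    show "locally_compact_space ?W"
      unfolding sorted_roots_topology_def
      by (intro locally_compact_space_closed_subset closedin_sorted_roots locally_compact_Euclidean_space)
    show "\<phi> 0 x = x" if "x \<in> topspace ?W" for x
      using that by (auto simp: \<phi>_def sorted_roots_def)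
    fix K assume K: "compactin ?W K" "closedin ?W K"
    let ?P = "{(s,x). 0 \<le> s \<and> x \<in> topspace ?W \<and> \<phi> s x \<in> K}"
    obtain B where B: "\<forall>y\<in>K. \<forall>i<?t. \<bar>y i\<bar> \<le> B"
      using compactin_real_map_bounded[OF K(1), of ?t "\<lambda>x. x"] projW by auto
    \<comment> \<open>\<open>3 * B\<close> is \<open>B\<close> for the pushed root
      \<open>x j + s\<close> plus \<open>2 * B\<close> for the push \<open>s\<close>.\<close>
    let ?Q = "{x \<in> topspace ?W. \<forall>i<?t. x i \<in> {- 3 * B..3 * B}}"
    have "closedin ?W ?Q"
    proof -
      have "?Q = topspace ?W \<inter> (\<Inter>i\<in>{..<?t}. {x \<in> topspace ?W. x i \<in> {- 3 * B..3 * B}})" by auto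
      moreover have "closedin ?W {x \<in> topspace ?W. x i \<in> {- 3 * B..3 * B}}" for i
        by (intro closedin_continuous_map_preimage[where Y=euclideanreal] projW) auto
      ultimately show ?thesis
        using j by (metis (no_types, lifting) closedin_Int closedin_INT closedin_topspace emptyE lessThan_iff)
    qed
    then have "compactin ?W ?Q"
      by (rule compactin_sorted_roots_bounded[where B="3 * B"]) (auto simp: abs_le_iff)
    then have "compactin (prod_topology ?R ?W) ({0..2 * B} \<times> ?Q)"
      by (simp add: compactin_Times compactin_subtopology)
    moreover have "closedin (prod_topology ?R ?W) ?P"
    proof -
      have "?P = {z \<in> topspace (prod_topology ?R ?W). (\<lambda>(s,x). \<phi> s x) z \<in> K}" by auto
      then show ?thesis using closedin_continuous_map_preimage[OF cont K(2)] by simp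
    qed
    moreover have "?P \<subseteq> {0..2 * B} \<times> ?Q"
    proof clarify
      fix s x assume sx: "0 \<le> s" "x \<in> topspace ?W" "\<phi> s x \<in> K"
      have b: "\<bar>\<phi> s x i\<bar> \<le> B" if "i < ?t" for i using B sx that by blast
      have others: "\<bar>x i\<bar> \<le> B" if "i < ?t" "i \<noteq> j" for i
        using b[OF that(1)] that by (simp add: \<phi>_def)
      \<comment> \<open>From \<open>- B \<le> x i\<^sub>0 \<le> x j\<close> and
        \<open>x j + s \<le> B\<close> the push is at most \<open>2 * B\<close>.\<close>
      have "x i\<^sub>0 \<le> x j" using sx(2) i0j j by (simp add: sorted_roots_def)
      moreover have "\<bar>x i\<^sub>0\<bar> \<le> B" using others[of i\<^sub>0] i0j j by simp
      moreover have "\<bar>x j + s\<bar> \<le> B" using b[OF j(1)] j by (simp add: \<phi>_def)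
      ultimately have s: "s \<le> 2 * B" and "\<bar>x j\<bar> \<le> 3 * B" and "0 \<le> B"
        using sx(1) by linarith+
      then have "\<bar>x i\<bar> \<le> 3 * B" if "i < ?t" for i
        using others[OF that] by (cases "i = j") auto
      then show "s \<in> {0..2 * B} \<and> x \<in> ?Q" using sx s by (auto simp: abs_le_iff minus_le_iff)
    qed
    ultimately show "compactin (prod_topology ?R ?W) ?P"
      by (metis (no_types, lifting) closed_compactin)
  qed
qed

section \<open>Distinct parts and exponential notation\<close>

text \<open>Without equal parts the order condition is vacuous, and the cone is all of Euclidean
  space.\<close>

lemma sorted_roots_topology_distinct:
  assumes "distinct ps"
  shows "sorted_roots_topology ps = Euclidean_space (length ps)"
proof -
  have "sorted_roots ps = topspace (Euclidean_space (length ps))"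
    using assms by (auto simp: sorted_roots_def topspace_Euclidean_space nth_eq_iff_index_eq)
  then show ?thesis by (simp add: sorted_roots_topology_def)
qed

lemma length_exponential_list: "length (exponential_list n e) = (\<Sum>i=1..n. e i)"
proof -
  have "length (exponential_list n e) = sum_list (map e [1..<n + 1])"
    by (simp add: exponential_list_def length_concat o_def)
  also have "\<dots> = (\<Sum>i=1..n. e i)"
    by (metis Suc_eq_plus1 atLeastLessThanSuc_atLeastAtMost interv_sum_list_conv_sum_set_nat set_upt)
  finally show ?thesis .
qed

text \<open>Each step of the induction appends copies of a new value, and copies of one value are
  distinct only if there is at most one. This translates the case distinction on the exponents into
  one on \<open>ps\<close>.\<close>

lemma distinct_exponential_list_iff:
  "distinct (exponential_list n e) \<longleftrightarrow> (\<forall>i\<in>{1..n}. e i \<le> 1)"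
proof (induction n)
  case (Suc n)
  have "exponential_list (Suc n) e = exponential_list n e @ replicate (e (Suc n)) (Suc n)"
    by (simp add: exponential_list_def)
  moreover have "Suc n \<notin> set (exponential_list n e)"
    by (auto simp: exponential_list_def)
  moreover have "distinct (replicate m a) \<longleftrightarrow> m \<le> 1" for m and a :: nat
    by (cases m; cases "m - 1") auto
  moreover have "{1..Suc n} = insert (Suc n) {1..n}" by auto
  ultimately show ?case
    using Suc by (auto simp del: replicate_Suc)
qed (simp add: exponential_list_def)

theorem theorem3p8:
  fixes n :: nat and e :: "nat \<Rightarrow> nat" and ps :: "nat list"
  assumes "number_partition n ps"
    and "ps = exponential_list n e"
    and "free_of_resonances ps"
  shows "((\<exists>i\<in>{1..n}. e i \<ge> 2) \<longrightarrow>
            contractible_space (Alexandroff_compactification (Hyp_topology n ps))) \<and>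
         ((\<forall>i\<in>{1..n}. 0 \<le> e i \<and> e i \<le> 1) \<longrightarrow>
            Alexandroff_compactification (Hyp_topology n ps)
              homeomorphic_space nsphere (\<Sum>i=1..n. e i))"
proof -
  \<comment> \<open>The problem is moved to the cone of sorted roots; the partition supplies
    positivity of the parts and the degree \<open>n\<close>.\<close>
  have "homeomorphic_map (sorted_roots_topology ps) (Hyp_topology n ps) (root_poly ps)"
    using assms(1,3) by (intro homeomorphic_map_root_poly) (auto simp: number_partition_def)
  then have hom: "Alexandroff_compactification (sorted_roots_topology ps)
      homeomorphic_space Alexandroff_compactification (Hyp_topology n ps)"
    by (intro homeomorphic_space_Alexandroff_compactification homeomorphic_map_imp_homeomorphic_space)
  have dist: "distinct ps \<longleftrightarrow> (\<forall>i\<in>{1..n}. e i \<le> 1)"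
    using distinct_exponential_list_iff assms(2) by simp
  show ?thesis
  proof (intro conjI impI)
    assume "\<exists>i\<in>{1..n}. e i \<ge> 2"
    then have "\<not> distinct ps" using dist by fastforce
    then show "contractible_space (Alexandroff_compactification (Hyp_topology n ps))"
      using contractible_Alexandroff_sorted_roots homeomorphic_space_contractibility[OF hom] by blast
  next
    assume "\<forall>i\<in>{1..n}. 0 \<le> e i \<and> e i \<le> 1"
    then have "distinct ps" by (simp add: dist)
    then have "Alexandroff_compactification (sorted_roots_topology ps) homeomorphic_space nsphere (length ps)"
      by (simp add: sorted_roots_topology_distinct Alexandroff_compactification_Euclidean_space)
    then show "Alexandroff_compactification (Hyp_topology n ps) homeomorphic_space nsphere (\<Sum>i=1..n. e i)"
      using hom assms(2) length_exponential_list homeomorphic_space_sym homeomorphic_space_trans by metis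
  qed
qed

end
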